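(* Let $a$ and $m$ be positive integers with $a+1\leq m\leq 2a+1$, and let $R_2(m,a)$ denote the 2-color Rado number of $x_1+x_2+\cdots+x_{m-1}=ax_m$. Then $R_2(m,a)=1$ if and only if $m=a+1$. If $a+2\leq m\leq 2a+1$, then $R_2(m,a)\in\{3,4,5\}$, and: $R_2(m,a)=3$ iff $m\leq \frac{3a}{2}+1$ and $a\equiv m-1 \pmod 2$; $R_2(m,a)=4$ iff either (i) $m\leq\frac{3a}{2}+1$ and $a\not\equiv m-1\pmod 2$, or (ii) $m>\frac{3a}{2}+1$ and $a\equiv m-1\pmod 3$; $R_2(m,a)=5$ iff $m>\frac{3a}{2}+1$ and $a\not\equiv m-1\pmod 3$.
   Context: The 2-color Rado number $R_2(m,a)$ of $x_1+\cdots+x_{m-1}=ax_m$ is the least positive integer $n$ such that for every coloring of $[n]=\{1,\dots,n\}$ with two colors there exist $x_1,\dots,x_m\in[n]$ (not necessarily distinct), all of the same color, satisfying the equation. *)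

theory Defs
  imports Complex_Main "HOL-Library.Extended_Nat" "HOL-Number_Theory.Cong"
begin

text \<open>
  A 2-coloring is a function into the two-element type \<^typ>\<open>bool\<close>; only its values on
  \<open>{1..n}\<close> matter below. The variables of the equation are \<open>x 1, \<dots>, x m\<close>.
\<close>

definition mono_solution :: "nat \<Rightarrow> nat \<Rightarrow> nat \<Rightarrow> (nat \<Rightarrow> bool) \<Rightarrow> (nat \<Rightarrow> nat) \<Rightarrow> bool" where
  "mono_solution m a n c x \<longleftrightarrow>
     (\<forall>i\<in>{1..m}. x i \<in> {1..n}) \<and>
     (\<forall>i\<in>{1..m}. \<forall>j\<in>{1..m}. c (x i) = c (x j)) \<and>
     (\<Sum>i = 1..m - 1. x i) = a * x m"

text \<open>
  The value is an extended natural number, so that it is \<open>\<infinity>\<close> (the infimum of the empty set)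
  when no suitable \<open>n\<close> exists; otherwise it is the least such \<open>n\<close>.
\<close>

definition rado_number2 :: "nat \<Rightarrow> nat \<Rightarrow> enat" where
  "rado_number2 m a =
     Inf (enat ` {n. n \<ge> 1 \<and> (\<forall>c :: nat \<Rightarrow> bool. \<exists>x. mono_solution m a n c x)})"

end

theory Submission
  imports Defs
begin

text \<open>
  Put \<open>k = m - 1\<close>. A solution with values in \<open>{p, q, r}\<close> and \<open>x m = r\<close> amounts to multiplicities
  \<open>u + v + w = k\<close> with \<open>p u + q v + r w = a r\<close>. For \<open>a < k \<le> 2 a\<close> there is always a solution with
  values in each of \<open>{1,2}\<close>, \<open>{2,4}\<close>, \<open>{1,3,4}\<close>, \<open>{1,4,5}\<close>, \<open>{2,3,5}\<close>, while \<open>{2,3}\<close>, \<open>{1,3}\<close>, \<open>{1,4}\<close>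
  admit one precisely when \<open>2 k \<le> 3 a\<close>, \<open>k \<equiv> a (mod 2)\<close>, \<open>k \<equiv> a (mod 3)\<close>, respectively. Since each
  of these classes must be split between the colours, the upper bounds follow. The lower bounds
  come from the colourings \<open>{1} | {2}\<close>, \<open>{1,3} | {2}\<close>, \<open>{1} | {2,3}\<close> and \<open>{1,4} | {2,3}\<close>.
\<close>

section \<open>Reduction of the Rado number to two consecutive interval lengths\<close>

definition unavoidable :: "nat \<Rightarrow> nat \<Rightarrow> nat \<Rightarrow> bool" where
  "unavoidable m a n \<longleftrightarrow> (\<forall>c. \<exists>x. mono_solution m a n c x)"

lemma unavoidable_mono:
  assumes "unavoidable m a n" "n \<le> n'"
  shows "unavoidable m a n'"
proof -
  have "{1..n} \<subseteq> {1..n'}"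
    using assms(2) by simp
  then have "mono_solution m a n' c x" if "mono_solution m a n c x" for c x
    using that unfolding mono_solution_def by blast
  then show ?thesis
    using assms(1) unfolding unavoidable_def by blast
qed

text \<open>By monotonicity, one avoiding colouring at \<open>n\<close> excludes every smaller
  length too. For \<open>n = 0\<close> nothing has to be excluded, since candidates start at
  1.\<close>

lemma rado_number2_eqI:
  assumes "unavoidable m a (Suc n)" and "n = 0 \<or> \<not> unavoidable m a n"
  shows "rado_number2 m a = enat (Suc n)"
proof -
  let ?S = "{n. n \<ge> 1 \<and> (\<forall>c :: nat \<Rightarrow> bool. \<exists>x. mono_solution m a n c x)}"
  have "Suc n \<in> ?S"
    using assms(1) by (simp add: unavoidable_def)
  moreover have "Suc n \<le> l" if "l \<in> ?S" for l
    using that assms(2) unavoidable_mono[of m a l n]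
    by (force simp: unavoidable_def not_less_eq_eq)
  ultimately show ?thesis
    unfolding rado_number2_def by (intro Inf_eqI) auto
qed

section \<open>Solutions from prescribed multiplicities\<close>

lemma mono_solution_three_values:
  assumes range: "p \<in> {1..n}" "q \<in> {1..n}" "r \<in> {1..n}"
    and col: "c p = c r" "c q = c r"
    and count: "u + v + w = k" and eq: "p * u + q * v + r * w = a * r"
  shows "\<exists>x. mono_solution (Suc k) a n c x"
proof -
  \<comment> \<open>The values are laid out in consecutive blocks of lengths \<open>u\<close>,
    \<open>v\<close>, \<open>w\<close>. The index \<open>Suc k\<close> lies beyond
    \<open>u + v\<close>, so the right-hand variable gets \<open>r\<close>.\<close>
  define x where "x i = (if i \<le> u then p else if i \<le> u + v then q else r)" for i
  have "sum x {1..k} = sum x {1..u} + sum x {u+1..u+v} + sum x {u+v+1..k}"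
    using sum.ub_add_nat[of 1 u x v] sum.ub_add_nat[of 1 "u + v" x w] count by simp
  also have "sum x {1..u} = (\<Sum>i=1..u. p)"
    by (intro sum.cong) (auto simp: x_def)
  also have "sum x {u+1..u+v} = (\<Sum>i=u+1..u+v. q)"
    by (intro sum.cong) (auto simp: x_def)
  also have "sum x {u+v+1..k} = (\<Sum>i=u+v+1..k. r)"
    by (intro sum.cong) (auto simp: x_def)
  also have "(\<Sum>i=1..u. p) + (\<Sum>i=u+1..u+v. q) + (\<Sum>i=u+v+1..k. r) = a * x (Suc k)"
    using eq count by (auto simp: x_def algebra_simps)
  finally have "sum x {1..k} = a * x (Suc k)" .
  then have "mono_solution (Suc k) a n c x"
    using range col unfolding mono_solution_def by (auto simp: x_def)
  then show ?thesis by blast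
qed

lemma mono_solution_two_values:
  assumes "p \<in> {1..n}" "r \<in> {1..n}" "c p = c r"
    and "u + w = k" and "p * u + r * w = a * r"
  shows "\<exists>x. mono_solution (Suc k) a n c x"
  by (rule mono_solution_three_values[of p n p r c u 0 w k a]) (use assms in simp_all)

text \<open>Dividing by \<open>p\<close> leaves \<open>u + w = k\<close> and
  \<open>u + 2 * w = 2 * a\<close>; the solution is nonnegative exactly when
  \<open>a \<le> k \<le> 2 * a\<close>.\<close>

lemma solution_doubling:
  assumes "p \<in> {1..n}" "2 * p \<in> {1..n}" "c p = c (2 * p)" and "a \<le> k" "k \<le> 2 * a"
  shows "\<exists>x. mono_solution (Suc k) a n c x"
proof (rule mono_solution_two_values[of p n "2 * p" c "2 * (k - a)" "2 * a - k"])
  have "p * (2 * (k - a)) + 2 * p * (2 * a - k) = 2 * p * ((k - a) + (2 * a - k))"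
    by (simp only: algebra_simps)
  also have "(k - a) + (2 * a - k) = a"
    using assms by simp
  finally show "p * (2 * (k - a)) + 2 * p * (2 * a - k) = a * (2 * p)"
    by simp
qed (use assms in auto)

lemma solution_2_3:
  assumes "3 \<le> n" "c 2 = c 3" "a \<le> k" "2 * k \<le> 3 * a"
  shows "\<exists>x. mono_solution (Suc k) a n c x"
proof -
  obtain d where d: "k = a + d"
    using assms(3) le_Suc_ex by blast
  then obtain e where "a = 2 * d + e"
    using assms(4) le_Suc_ex[of "2 * d" a] by auto
  then show ?thesis
    \<comment> \<open>Solving \<open>u + w = k\<close>, \<open>2 * u + 3 * w = 3 * a\<close> gives
      \<open>u = 3 * (k - a)\<close> and \<open>w = 3 * a - 2 * k\<close>, which are
      \<open>3 * d\<close> and \<open>e\<close>.\<close>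
    using d assms(1,2) by (intro mono_solution_two_values[of 2 n 3 c "3 * d" e]) auto
qed

text \<open>The multiplicity \<open>w\<close> of 3 must satisfy \<open>2 * w = 3 * a - k\<close>, so
  only parity can obstruct; \<open>k = a + 2 * j\<close> gives \<open>w = a - j\<close>.\<close>

lemma solution_1_3:
  assumes "3 \<le> n" "c 1 = c 3" "a \<le> k" "k \<le> 2 * a" "[a = k] (mod 2)"
  shows "\<exists>x. mono_solution (Suc k) a n c x"
proof -
  obtain j where "k = j * 2 + a"
    using assms(3,5) by (metis cong_le_nat cong_sym)
  then show ?thesis
    by (intro mono_solution_two_values[of 1 n 3 c "k - (a - j)" "a - j"]) (use assms in auto)
qed

text \<open>Here \<open>3 * w = 4 * a - k\<close> for the multiplicity \<open>w\<close> of 4, so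
  \<open>k = a + 3 * j\<close> again gives \<open>w = a - j\<close>.\<close>

lemma solution_1_4:
  assumes "4 \<le> n" "c 1 = c 4" "a \<le> k" "k \<le> 2 * a" "[a = k] (mod 3)"
  shows "\<exists>x. mono_solution (Suc k) a n c x"
proof -
  obtain j where "k = j * 3 + a"
    using assms(3,5) by (metis cong_le_nat cong_sym)
  then show ?thesis
    by (intro mono_solution_two_values[of 1 n 4 c "k - (a - j)" "a - j"]) (use assms in auto)
qed

text \<open>Start from \<open>k\<close> ones and raise \<open>v\<close> of them to 3 and
  \<open>w\<close> to 4: the deficit \<open>4 * a - k\<close> must be \<open>2 * v + 3 * w\<close>.
  Only 1 is a positive integer not of this form, and the deficit is at least
  \<open>2 * a\<close>.\<close>

lemma solution_1_3_4:
  assumes "4 \<le> n" "c 1 = c 4" "c 3 = c 4" "1 \<le> a" "a \<le> k" "k \<le> 2 * a"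
  shows "\<exists>x. mono_solution (Suc k) a n c x"
proof -
  have "\<exists>s. t = 3 * s \<or> t = 3 * s + 1 \<or> t = 3 * s + 2" for t :: nat
    by presburger
  then obtain s where "4 * a - k = 3 * s \<or> 4 * a - k = 3 * s + 1 \<or> 4 * a - k = 3 * s + 2"
    by blast
  then have "4 * a = k + 3 * s \<or> 4 * a = k + 3 * s + 1 \<or> 4 * a = k + 3 * s + 2"
    using assms(5,6) by linarith
  then have "\<exists>v w. 4 * a = k + 2 * v + 3 * w \<and> v + w \<le> k"
  proof (elim disjE)
    assume "4 * a = k + 3 * s"
    then show ?thesis
      using assms(5,6) by (intro exI[of _ 0] exI[of _ s] conjI; linarith)
  next
    assume s: "4 * a = k + 3 * s + 1"
    then obtain s' where "s = Suc s'"
      using assms(4-6) by (cases s) auto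
    with s show ?thesis
      using assms(5,6) by (intro exI[of _ 2] exI[of _ s'] conjI; linarith)
  next
    assume "4 * a = k + 3 * s + 2"
    then show ?thesis
      using assms(5,6) by (intro exI[of _ 1] exI[of _ s] conjI; linarith)
  qed
  then obtain v w where "4 * a = k + 2 * v + 3 * w" "v + w \<le> k"
    by blast
  then show ?thesis
    by (intro mono_solution_three_values[of 1 n 3 4 c "k - (v + w)" v w]) (use assms in auto)
qed

text \<open>Raising ones to 4 or 5 requires \<open>5 * a - k = 3 * v + 4 * w\<close>. The residue
  modulo 4 fixes \<open>v \<le> 3\<close>; the positive integers to avoid are 1, 2 and 5.\<close>

lemma solution_1_4_5:
  assumes "5 \<le> n" "c 1 = c 5" "c 4 = c 5" "a < k" "k \<le> 2 * a"
  shows "\<exists>x. mono_solution (Suc k) a n c x"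
proof -
  have "\<exists>s. t = 4 * s \<or> t = 4 * s + 1 \<or> t = 4 * s + 2 \<or> t = 4 * s + 3" for t :: nat
    by presburger
  then obtain s where "5 * a - k = 4 * s \<or> 5 * a - k = 4 * s + 1 \<or>
      5 * a - k = 4 * s + 2 \<or> 5 * a - k = 4 * s + 3"
    by blast
  then have "5 * a = k + 4 * s \<or> 5 * a = k + 4 * s + 1 \<or>
      5 * a = k + 4 * s + 2 \<or> 5 * a = k + 4 * s + 3"
    using assms(4,5) by linarith
  then have "\<exists>v w. 5 * a = k + 3 * v + 4 * w \<and> v + w \<le> k"
  proof (elim disjE)
    assume "5 * a = k + 4 * s"
    then show ?thesis
      using assms(4,5) by (intro exI[of _ 0] exI[of _ s] conjI; linarith)
  next
    assume s: "5 * a = k + 4 * s + 1"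
    \<comment> \<open>This excludes the deficits 1 and 5: they would force \<open>a = 1\<close> and
      \<open>k = 2\<close>, where the deficit is 3.\<close>
    have "2 \<le> s"
    proof (rule ccontr)
      assume "\<not> 2 \<le> s"
      then have "a \<le> 1"
        using s assms(5) by linarith
      then have "a = 1" "k = 2"
        using assms(4,5) by linarith+
      then show False
        using s by presburger
    qed
    then obtain s' where "s = 2 + s'"
      using le_Suc_ex by blast
    with s show ?thesis
      using assms(4,5) by (intro exI[of _ 3] exI[of _ s'] conjI; linarith)
  next
    assume s: "5 * a = k + 4 * s + 2"
    then obtain s' where "s = Suc s'"
      using assms(4,5) by (cases s) auto
    with s show ?thesis
      using assms(4,5) by (intro exI[of _ 2] exI[of _ s'] conjI; linarith)
  next
    assume "5 * a = k + 4 * s + 3"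
    then show ?thesis
      using assms(4,5) by (intro exI[of _ 1] exI[of _ s] conjI; linarith)
  qed
  then obtain v w where "5 * a = k + 3 * v + 4 * w" "v + w \<le> k"
    by blast
  then show ?thesis
    by (intro mono_solution_three_values[of 1 n 4 5 c "k - (v + w)" v w]) (use assms in auto)
qed

text \<open>Raising twos to 3 or 5 costs 1 or 3, so division of \<open>5 * a - 2 * k\<close> by 3
  gives \<open>v\<close> and \<open>w\<close>. As \<open>a < k\<close>, this deficit is at most
  \<open>3 * a - 2\<close>, whence \<open>v + w \<le> a\<close>.\<close>

lemma solution_2_3_5:
  assumes "5 \<le> n" "c 2 = c 5" "c 3 = c 5" "a < k" "k \<le> 2 * a"
  shows "\<exists>x. mono_solution (Suc k) a n c x"
proof -
  define v where "v = (5 * a - 2 * k) mod 3"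
  define w where "w = (5 * a - 2 * k) div 3"
  have sum: "5 * a = 2 * k + v + 3 * w" and "v \<le> 2"
    using assms by (auto simp: v_def w_def)
  moreover from this have "v + w \<le> k"
    using assms by arith
  ultimately show ?thesis
    by (intro mono_solution_three_values[of 2 n 3 5 c "k - (v + w)" v w]) (use assms in auto)
qed

section \<open>Upper bounds: every colouring has a solution\<close>

lemma unavoidable_3:
  assumes "a \<le> k" "2 * k \<le> 3 * a" "[a = k] (mod 2)"
  shows "unavoidable (Suc k) a 3"
  unfolding unavoidable_def
proof
  fix c :: "nat \<Rightarrow> bool"
  consider "c 1 = c 2" | "c 2 = c 3" | "c 1 = c 3" by blast
  then show "\<exists>x. mono_solution (Suc k) a 3 c x"
  proof cases
    case 1
    then show ?thesis
      using assms by (intro solution_doubling[of 1]) auto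
  next
    case 2
    then show ?thesis
      using assms by (intro solution_2_3) auto
  next
    case 3
    then show ?thesis
      using assms by (intro solution_1_3) auto
  qed
qed

text \<open>Unless doubling applies, 2 differs in colour from 1 and 4, so 1 and 4 agree. Either that
  pair suffices, or 3 joins 2 or joins 1 and 4.\<close>

lemma unavoidable_4:
  assumes "1 \<le> a" "a \<le> k" "k \<le> 2 * a" and "2 * k \<le> 3 * a \<or> [a = k] (mod 3)"
  shows "unavoidable (Suc k) a 4"
  unfolding unavoidable_def
proof
  fix c :: "nat \<Rightarrow> bool"
  consider "c 1 = c 2" | "c 2 = c 4" | "c 1 = c 4" "[a = k] (mod 3)"
    | "c 2 = c 3" "2 * k \<le> 3 * a" | "c 1 = c 4" "c 3 = c 4"
    using assms(4) by argo
  then show "\<exists>x. mono_solution (Suc k) a 4 c x"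
  proof cases
    case 1
    then show ?thesis
      using assms by (intro solution_doubling[of 1]) auto
  next
    case 2
    then show ?thesis
      using assms by (intro solution_doubling[of 2]) auto
  next
    case 3
    then show ?thesis
      using assms by (intro solution_1_4) auto
  next
    case 4
    then show ?thesis
      using assms by (intro solution_2_3) auto
  next
    case 5
    then show ?thesis
      using assms by (intro solution_1_3_4) auto
  qed
qed

text \<open>If the first three cases fail, 1 and 4 share one colour and 2 and 3 the other; 5 then
  completes one of two solvable triples.\<close>

lemma unavoidable_5:
  assumes "a < k" "k \<le> 2 * a"
  shows "unavoidable (Suc k) a 5"
  unfolding unavoidable_def
proof
  fix c :: "nat \<Rightarrow> bool"
  consider "c 1 = c 2" | "c 2 = c 4" | "c 1 = c 4" "c 3 = c 4"
    | "c 1 = c 5" "c 4 = c 5" | "c 2 = c 5" "c 3 = c 5"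
    by argo
  then show "\<exists>x. mono_solution (Suc k) a 5 c x"
  proof cases
    case 1
    then show ?thesis
      using assms by (intro solution_doubling[of 1]) auto
  next
    case 2
    then show ?thesis
      using assms by (intro solution_doubling[of 2]) auto
  next
    case 3
    then show ?thesis
      using assms by (intro solution_1_3_4) auto
  next
    case 4
    then show ?thesis
      using assms by (intro solution_1_4_5) auto
  next
    case 5
    then show ?thesis
      using assms by (intro solution_2_3_5) auto
  qed
qed

section \<open>Lower bounds: colourings without solutions\<close>

lemma not_unavoidableI:
  fixes c :: "nat \<Rightarrow> bool"
  assumes "\<And>x. \<lbrakk>\<And>i. i \<in> {1..Suc k} \<Longrightarrow> x i \<in> {1..n}; \<And>i. i \<in> {1..Suc k} \<Longrightarrow> c (x i) = c (x (Suc k));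
      (\<Sum>i=1..k. x i) = a * x (Suc k)\<rbrakk> \<Longrightarrow> False"
  shows "\<not> unavoidable (Suc k) a n"
proof
  assume "unavoidable (Suc k) a n"
  then obtain x where x: "mono_solution (Suc k) a n c x"
    unfolding unavoidable_def by blast
  have "Suc k \<in> {1..Suc k}"
    by simp
  show False
  proof (rule assms)
    show "x i \<in> {1..n}" if "i \<in> {1..Suc k}" for i
      using x that unfolding mono_solution_def by blast
    show "c (x i) = c (x (Suc k))" if "i \<in> {1..Suc k}" for i
      using x that \<open>Suc k \<in> {1..Suc k}\<close> unfolding mono_solution_def by blast
    show "(\<Sum>i=1..k. x i) = a * x (Suc k)"
      using x unfolding mono_solution_def diff_Suc_1 by blast
  qed
qed

lemma sum_ge_min:
  fixes x :: "nat \<Rightarrow> nat"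
  assumes "\<And>i. i \<in> {1..k} \<Longrightarrow> p \<le> x i"
  shows "k * p \<le> (\<Sum>i=1..k. x i)"
proof -
  have "k * p = (\<Sum>i=1..k. p)"
    by simp
  also have "\<dots> \<le> (\<Sum>i=1..k. x i)"
    by (rule sum_mono) (rule assms)
  finally show ?thesis .
qed

lemma sum_cong_card:
  fixes x :: "nat \<Rightarrow> nat"
  assumes "\<And>i. i \<in> {1..k} \<Longrightarrow> [x i = 1] (mod q)"
  shows "[(\<Sum>i=1..k. x i) = k] (mod q)"
proof -
  have "[(\<Sum>i=1..k. x i) = (\<Sum>i=1..k. 1)] (mod q)"
    by (rule cong_sum) (rule assms)
  then show ?thesis
    by simp
qed

text \<open>Both colour classes are singletons, so a solution would be constant and force
  \<open>k = a\<close>.\<close>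

lemma not_unavoidable_2:
  assumes "a < k"
  shows "\<not> unavoidable (Suc k) a 2"
proof (rule not_unavoidableI[where c = "\<lambda>i. i = 1"])
  fix x :: "nat \<Rightarrow> nat"
  assume range: "\<And>i. i \<in> {1..Suc k} \<Longrightarrow> x i \<in> {1..2}"
    and col: "\<And>i. i \<in> {1..Suc k} \<Longrightarrow> (x i = 1) = (x (Suc k) = 1)"
    and eq: "(\<Sum>i=1..k. x i) = a * x (Suc k)"
  have "x (Suc k) \<le> x i" if "i \<in> {1..k}" for i
    using range[of i] range[of "Suc k"] col[of i] that by force
  then have "k * x (Suc k) \<le> a * x (Suc k)"
    using sum_ge_min eq by metis
  then show False
    using assms range[of "Suc k"] by simp
qed

lemma not_unavoidable_3_parity:
  assumes "a < k" "\<not> [a = k] (mod 2)"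
  shows "\<not> unavoidable (Suc k) a 3"
proof (rule not_unavoidableI[where c = "\<lambda>i. i = 2"])
  fix x :: "nat \<Rightarrow> nat"
  assume range: "\<And>i. i \<in> {1..Suc k} \<Longrightarrow> x i \<in> {1..3}"
    and col: "\<And>i. i \<in> {1..Suc k} \<Longrightarrow> (x i = 2) = (x (Suc k) = 2)"
    and eq: "(\<Sum>i=1..k. x i) = a * x (Suc k)"
  consider "x (Suc k) = 1" | "x (Suc k) = 2" | "x (Suc k) = 3"
    using range[of "Suc k"] by force
  then show False
  proof cases
    case 1
    have "k * 1 \<le> (\<Sum>i=1..k. x i)"
      by (rule sum_ge_min) (use range in force)
    with 1 eq assms show False by simp
  next
    case 2
    have "k * 2 \<le> (\<Sum>i=1..k. x i)"
      by (rule sum_ge_min) (use col 2 in force)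
    with 2 eq assms show False by simp
  next
    case 3
    \<comment> \<open>All summands are odd, so the sum has the parity of \<open>k\<close>, while the
      right side \<open>3 * a\<close> has that of \<open>a\<close>.\<close>
    have "[x i = 1] (mod 2)" if "i \<in> {1..k}" for i
    proof -
      have "x i = 1 \<or> x i = 3"
        using range[of i] col[of i] 3 that by force
      then show ?thesis by (auto simp: cong_def)
    qed
    then have "[3 * a = k] (mod 2)"
      using sum_cong_card[of k x 2] 3 eq by (simp add: mult.commute)
    then show False
      using assms(2) unfolding cong_def by presburger
  qed
qed

lemma not_unavoidable_3_large:
  assumes "a < k" "3 * a < 2 * k"
  shows "\<not> unavoidable (Suc k) a 3"
proof (rule not_unavoidableI[where c = "\<lambda>i. i = 1"])
  fix x :: "nat \<Rightarrow> nat"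
  assume range: "\<And>i. i \<in> {1..Suc k} \<Longrightarrow> x i \<in> {1..3}"
    and col: "\<And>i. i \<in> {1..Suc k} \<Longrightarrow> (x i = 1) = (x (Suc k) = 1)"
    and eq: "(\<Sum>i=1..k. x i) = a * x (Suc k)"
  show False
  proof (cases "x (Suc k) = 1")
    case True
    have "k * 1 \<le> (\<Sum>i=1..k. x i)"
      by (rule sum_ge_min) (use range in force)
    with True eq assms show False by simp
  next
    case False
    \<comment> \<open>In the class of 2 and 3 the left side is at least \<open>2 * k\<close> and the
      right side at most \<open>3 * a\<close>.\<close>
    have "2 \<le> x i" if "i \<in> {1..k}" for i
      using range[of i] col[of i] False that by force
    then have "k * 2 \<le> a * x (Suc k)"
      using sum_ge_min eq by metis
    also have "\<dots> \<le> a * 3"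
      using range[of "Suc k"] by simp
    finally show False
      using assms by simp
  qed
qed

lemma not_unavoidable_4:
  assumes "a < k" "3 * a < 2 * k" "\<not> [a = k] (mod 3)"
  shows "\<not> unavoidable (Suc k) a 4"
proof (rule not_unavoidableI[where c = "\<lambda>i. i = 1 \<or> i = 4"])
  fix x :: "nat \<Rightarrow> nat"
  assume range: "\<And>i. i \<in> {1..Suc k} \<Longrightarrow> x i \<in> {1..4}"
    and col: "\<And>i. i \<in> {1..Suc k} \<Longrightarrow>
      (x i = 1 \<or> x i = 4) = (x (Suc k) = 1 \<or> x (Suc k) = 4)"
    and eq: "(\<Sum>i=1..k. x i) = a * x (Suc k)"
  consider "x (Suc k) = 1" | "x (Suc k) \<in> {2, 3}" | "x (Suc k) = 4"
    using range[of "Suc k"] by force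
  then show False
  proof cases
    case 1
    have "k * 1 \<le> (\<Sum>i=1..k. x i)"
      by (rule sum_ge_min) (use range in force)
    with 1 eq assms show False by simp
  next
    case 2
    have "2 \<le> x i" if "i \<in> {1..k}" for i
      using range[of i] col[of i] 2 that by force
    then have "k * 2 \<le> a * x (Suc k)"
      using sum_ge_min eq by metis
    also have "\<dots> \<le> a * 3"
      using 2 by auto
    finally show False
      using assms by simp
  next
    case 3
    \<comment> \<open>Both 1 and 4 are 1 modulo 3, so the equation reduces to \<open>k\<close>
      congruent to \<open>4 * a\<close>, hence to \<open>a\<close>.\<close>
    have "[x i = 1] (mod 3)" if "i \<in> {1..k}" for i
    proof -
      have "x i = 1 \<or> x i = 4"
        using col[of i] 3 that by force
      then show ?thesis by (auto simp: cong_def)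
    qed
    then have "[4 * a = k] (mod 3)"
      using sum_cong_card[of k x 3] 3 eq by (simp add: mult.commute)
    then show False
      using assms(3) unfolding cong_def by presburger
  qed
qed

section \<open>Exact values\<close>

lemma rado_number2_trivial: "rado_number2 (Suc a) a = 1"
proof -
  have "unavoidable (Suc a) a (Suc 0)"
    unfolding unavoidable_def
    using mono_solution_two_values[of 1 1 1 _ 0 a a a] by simp
  then show ?thesis
    using rado_number2_eqI[of "Suc a" a 0] by (simp add: one_enat_def)
qed

lemma rado_number2_eq:
  assumes "a < k" "k \<le> 2 * a"
  shows "rado_number2 (Suc k) a =
    (if 2 * k \<le> 3 * a then if [a = k] (mod 2) then 3 else 4
     else if [a = k] (mod 3) then 4 else 5)"
proof -
  have "rado_number2 (Suc k) a = 3" if "2 * k \<le> 3 * a" "[a = k] (mod 2)"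
    using rado_number2_eqI[of "Suc k" a 2] unavoidable_3[of a k] not_unavoidable_2[of a k]
      that assms by (simp add: numeral_eq_enat)
  moreover have "rado_number2 (Suc k) a = 4"
    if "2 * k \<le> 3 * a \<and> \<not> [a = k] (mod 2) \<or> \<not> 2 * k \<le> 3 * a \<and> [a = k] (mod 3)"
  proof -
    \<comment> \<open>The parity colouring handles the first alternative, the colouring separating 1
      from 2 and 3 the second.\<close>
    have "\<not> unavoidable (Suc k) a 3"
      using that assms not_unavoidable_3_parity[of a k] not_unavoidable_3_large[of a k] by auto
    moreover have "unavoidable (Suc k) a 4"
      using that assms by (intro unavoidable_4) auto
    ultimately show ?thesis
      using rado_number2_eqI[of "Suc k" a 3] by (simp add: numeral_eq_enat)
  qed
  moreover have "rado_number2 (Suc k) a = 5" if "\<not> 2 * k \<le> 3 * a" "\<not> [a = k] (mod 3)"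
    using rado_number2_eqI[of "Suc k" a 4] unavoidable_5[of a k] not_unavoidable_4[of a k]
      that assms by (simp add: numeral_eq_enat)
  ultimately show ?thesis by auto
qed

theorem theorem2:
  fixes a m :: nat
  assumes "a \<ge> 1" and "m \<ge> 1" and "a + 1 \<le> m" and "m \<le> 2 * a + 1"
  shows "(rado_number2 m a = 1 \<longleftrightarrow> m = a + 1) \<and>
    (a + 2 \<le> m \<longrightarrow>
      rado_number2 m a \<in> {3, 4, 5} \<and>
      (rado_number2 m a = 3 \<longleftrightarrow>
         real m \<le> 3 * real a / 2 + 1 \<and> [a = m - 1] (mod 2)) \<and>
      (rado_number2 m a = 4 \<longleftrightarrow>
         (real m \<le> 3 * real a / 2 + 1 \<and> \<not> [a = m - 1] (mod 2)) \<or>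
         (real m > 3 * real a / 2 + 1 \<and> [a = m - 1] (mod 3))) \<and>
      (rado_number2 m a = 5 \<longleftrightarrow>
         real m > 3 * real a / 2 + 1 \<and> \<not> [a = m - 1] (mod 3)))"
proof -
  obtain k where m: "m = Suc k"
    using assms(2) by (cases m) auto
  \<comment> \<open>With \<open>m = k + 1\<close> the real threshold becomes an inequality between
    naturals.\<close>
  have bound: "real m \<le> 3 * real a / 2 + 1 \<longleftrightarrow> 2 * k \<le> 3 * a"
    using m by (simp add: field_simps) linarith
  then have bound': "real m > 3 * real a / 2 + 1 \<longleftrightarrow> \<not> 2 * k \<le> 3 * a"
    by linarith
  show ?thesis
  proof (cases "k = a")
    case True
    then show ?thesis
      using rado_number2_trivial m by simp
  next
    case False
    then have "a < k" "k \<le> 2 * a"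
      using assms m by auto
    then show ?thesis
      unfolding bound bound' using m rado_number2_eq[of a k]
      by (auto simp: numeral_eq_enat one_enat_def)
  qed
qed

end
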